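(* Let $F$ be a filter, and let $X\subseteq[\mathbb N]^\infty$ be an $F$-scale. Then: (1) For each hereditarily Lindelöf $F$-Menger space $Y$, the product space $(X\cup[\mathbb N]^{<\infty})\times Y$ is $F^+$-Menger. (2) If $F$ is an ultrafilter, then the real set $X\cup[\mathbb N]^{<\infty}$ is productively $F$-Menger in the realm of hereditarily Lindelöf spaces; that is, for each hereditarily Lindelöf $F$-Menger space $Y$, the product space $(X\cup[\mathbb N]^{<\infty})\times Y$ is $F$-Menger.
   Context: $\mathbb N=\{1,2,\dots\}$. The family $P(\mathbb N)$ of all subsets of $\mathbb N$ is identified with the Cantor space $\{0,1\}^{\mathbb N}$, with its topology; $[\mathbb N]^{\infty}$ and $[\mathbb N]^{<\infty}$ are the subspaces of infinite and of finite subsets of $\mathbb N$, respectively. Each $a\in[\mathbb N]^\infty$ is identified with its increasing enumeration: $a(n)$ is the $n$-th element of $a$. For sets $a,b$, $a\subseteq^* b$ means $a\setminus b$ is finite. A semifilter is a nonempty set $S\subseteq[\mathbb N]^\infty$ such that $s\in S$, $b\in[\mathbb N]^\infty$ and $s\subseteq^* b$ imply $b\in S$. A filter is a semifilter closed under finite intersections; ultrafilters here are nonprincipal ultrafilters on $\mathbb N$. Let $S^+=\{a\in[\mathbb N]^\infty:\mathbb N\setminus a\notin S\}$. For $a,b\in[\mathbb N]^\infty$ let $[a\le b]=\{n: a(n)\le b(n)\}$, and for $R\subseteq[\mathbb N]^\infty$ write $a\le_R b$ if $[a\le b]\in R$. $\mathfrak b(S)$ is the minimal cardinality of a subset of $[\mathbb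 N]^\infty$ with no $\le_S$-upper bound in $[\mathbb N]^\infty$. A set $X\subseteq[\mathbb N]^\infty$ with $|X|\ge\mathfrak b(S)$ is an $S$-scale if for each $b\in[\mathbb N]^\infty$ there is $c\in[\mathbb N]^\infty$ such that $b\le_{S^+}c\le_S x$ for all but less than $\mathfrak b(S)$ elements $x\in X$. For a semifilter $S$, a topological space $X$ is $S$-Menger if for each sequence $\mathcal U_1,\mathcal U_2,\dots$ of open covers of $X$ there are finite sets $\mathcal F_1\subseteq\mathcal U_1,\mathcal F_2\subseteq\mathcal U_2,\dots$ such that $\{n: x\in\bigcup\mathcal F_n\}\in S$ for all points $x\in X$. *)

theory Defs
  imports "HOL-Analysis.Analysis"
begin

unbundle cardinal_syntax

section \<open>Sets of positive integers\<close>

abbreviation pos_nats :: "nat set" where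
  "pos_nats \<equiv> {1..}"

definition inf_sets :: "nat set set" where
  "inf_sets = {a. a \<subseteq> pos_nats \<and> infinite a}"

definition fin_sets :: "nat set set" where
  "fin_sets = {a. a \<subseteq> pos_nats \<and> finite a}"

text \<open>The power set of the positive integers with the topology that makes
  \<open>a \<mapsto> (characteristic function of a)\<close> a homeomorphism onto the Cantor space.\<close>

definition cantor_topology :: "nat set topology" where
  "cantor_topology =
     pullback_topology (Pow pos_nats) (\<lambda>a. restrict (\<lambda>n. n \<in> a) pos_nats)
       (product_topology (\<lambda>_. discrete_topology (UNIV :: bool set)) pos_nats)"

text \<open>\<open>nth_elem a n\<close> is the \<open>n\<close>-th element of \<open>a\<close> for \<open>n \<ge> 1\<close>; the library's \<^const>\<open>enumerate\<close> counts from \<open>0\<close>.\<close>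

definition nth_elem :: "nat set \<Rightarrow> nat \<Rightarrow> nat" where
  "nth_elem a n = enumerate a (n - 1)"

definition almost_subset :: "nat set \<Rightarrow> nat set \<Rightarrow> bool" where
  "almost_subset a b \<longleftrightarrow> finite (a - b)"

section \<open>Semifilters\<close>

definition semifilter :: "nat set set \<Rightarrow> bool" where
  "semifilter S \<longleftrightarrow> S \<noteq> {} \<and> S \<subseteq> inf_sets \<and>
     (\<forall>s\<in>S. \<forall>b\<in>inf_sets. almost_subset s b \<longrightarrow> b \<in> S)"

definition set_filter :: "nat set set \<Rightarrow> bool" where
  "set_filter F \<longleftrightarrow> semifilter F \<and> (\<forall>a\<in>F. \<forall>b\<in>F. a \<inter> b \<in> F)"

text \<open>All members of a \<^const>\<open>set_filter\<close> are infinite, so it is proper and nonprincipal.\<close>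

definition set_ultrafilter :: "nat set set \<Rightarrow> bool" where
  "set_ultrafilter F \<longleftrightarrow> set_filter F \<and> (\<forall>a. a \<subseteq> pos_nats \<longrightarrow> a \<in> F \<or> pos_nats - a \<in> F)"

definition dual_plus :: "nat set set \<Rightarrow> nat set set" where
  "dual_plus S = {a \<in> inf_sets. pos_nats - a \<notin> S}"

section \<open>Bounding numbers and scales\<close>

definition le_set :: "nat set \<Rightarrow> nat set \<Rightarrow> nat set" where
  "le_set a b = {n \<in> pos_nats. nth_elem a n \<le> nth_elem b n}"

definition le_on :: "nat set set \<Rightarrow> nat set \<Rightarrow> nat set \<Rightarrow> bool" where
  "le_on R a b \<longleftrightarrow> le_set a b \<in> R"

definition unbounded_on :: "nat set set \<Rightarrow> nat set set \<Rightarrow> bool" where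
  "unbounded_on S B \<longleftrightarrow> B \<subseteq> inf_sets \<and> \<not> (\<exists>c\<in>inf_sets. \<forall>b\<in>B. le_on S b c)"

text \<open>A cardinal is a well-order of minimal type, determined up to \<open>=o\<close>; the choice below
  picks a representative of the least cardinality of an unbounded set.\<close>

definition bounding_number :: "nat set set \<Rightarrow> nat set rel" where
  "bounding_number S =
     (SOME r. (\<exists>B. unbounded_on S B \<and> r = |B| ) \<and> (\<forall>B. unbounded_on S B \<longrightarrow> r \<le>o |B| ))"

lemma unbounded_on_inf_sets:
  assumes "semifilter S"
  shows "unbounded_on S inf_sets"
proof -
  have "\<not> (\<forall>b\<in>inf_sets. le_on S b c)" if c: "c \<in> inf_sets" for c
  proof -
    define a where "a = c - {LEAST n. n \<in> c}"
    have inf: "infinite c" and a: "a \<in> inf_sets"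
      using c by (auto simp: inf_sets_def a_def)
    have "enumerate a k = enumerate c (Suc k)" for k
      by (simp add: a_def enumerate_Suc)
    then have "enumerate c k < enumerate a k" for k
      using enumerate_step[OF inf] by simp
    then have "le_set a c = {}"
      by (auto simp: le_set_def nth_elem_def not_le)
    then have "\<not> le_on S a c"
      using assms by (auto simp: le_on_def semifilter_def inf_sets_def)
    with a show ?thesis by blast
  qed
  then show ?thesis by (auto simp: unbounded_on_def)
qed

lemma bounding_number_minimal:
  assumes "semifilter S"
  shows "\<exists>B. unbounded_on S B \<and> bounding_number S = |B|"
    and "unbounded_on S B \<Longrightarrow> bounding_number S \<le>o |B|"
proof -
  let ?R = "card_of ` {B. unbounded_on S B}"
  have "?R \<noteq> {}" using unbounded_on_inf_sets[OF assms] by blast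
  then have "\<exists>r\<in>?R. \<forall>r'\<in>?R. r \<le>o r'"
    by (rule exists_minim_Card_order) (auto simp: card_of_Card_order)
  then have "\<exists>r. (\<exists>B. unbounded_on S B \<and> r = |B| ) \<and> (\<forall>B. unbounded_on S B \<longrightarrow> r \<le>o |B| )"
    by auto
  from someI_ex[OF this]
  show "\<exists>B. unbounded_on S B \<and> bounding_number S = |B|"
    and "unbounded_on S B \<Longrightarrow> bounding_number S \<le>o |B|"
    unfolding bounding_number_def by blast+
qed

definition is_scale :: "nat set set \<Rightarrow> nat set set \<Rightarrow> bool" where
  "is_scale S X \<longleftrightarrow> X \<subseteq> inf_sets \<and> bounding_number S \<le>o |X| \<and>
     (\<forall>b\<in>inf_sets. \<exists>c\<in>inf_sets.
        le_on (dual_plus S) b c \<and> |{x \<in> X. \<not> le_on S c x}| <o bounding_number S)"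

section \<open>Covering properties\<close>

definition open_cover :: "'a topology \<Rightarrow> 'a set set \<Rightarrow> bool" where
  "open_cover T \<U> \<longleftrightarrow> (\<forall>U\<in>\<U>. openin T U) \<and> \<Union>\<U> = topspace T"

definition Menger_space :: "nat set set \<Rightarrow> 'a topology \<Rightarrow> bool" where
  "Menger_space S T \<longleftrightarrow>
     (\<forall>\<U> :: nat \<Rightarrow> 'a set set. (\<forall>n\<in>pos_nats. open_cover T (\<U> n)) \<longrightarrow>
        (\<exists>\<F>. (\<forall>n\<in>pos_nats. finite (\<F> n) \<and> \<F> n \<subseteq> \<U> n) \<and>
             (\<forall>x\<in>topspace T. {n \<in> pos_nats. x \<in> \<Union>(\<F> n)} \<in> S)))"

definition hereditarily_Lindelof :: "'a topology \<Rightarrow> bool" where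
  "hereditarily_Lindelof T \<longleftrightarrow> (\<forall>A. A \<subseteq> topspace T \<longrightarrow> Lindelof_space (subtopology T A))"

end

theory Submission
  imports Defs
begin

text \<open>Each open cover of the product has an increasing sequence of finite subfamilies
  \<open>G n 0 \<subseteq> G n 1 \<subseteq> \<dots>\<close> that still cover it. By pigeonhole, every
  \<open>y\<close> has a neighbourhood \<open>V\<close> and a number \<open>k\<close> such that \<open>G n k\<close> covers \<open>{x} \<times> V\<close> for
  all \<open>x\<close> with fewer than \<open>n\<close> elements below \<open>k\<close>. The \<open>F\<close>-Menger property of \<open>Y\<close> turns
  this into one function \<open>k\<close> such that \<open>(x, y)\<close> is covered by \<open>G n (k n)\<close> for \<open>F\<close>-many of
  the \<open>n\<close> with \<open>k n \<le> x(n)\<close>. A scale provides \<open>F\<^sup>+\<close>-many such \<open>n\<close> for all but fewer than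
  \<open>\<bb>(F)\<close> points \<open>x\<close>. For each exceptional \<open>x\<close> the space \<open>{x} \<times> Y\<close> is \<open>F\<close>-Menger, and the
  corresponding functions have a common upper bound modulo \<open>F\<close>.\<close>

section \<open>Filters and the dual family \<open>dual_plus F\<close>\<close>

lemma set_filter_superset:
  assumes "set_filter F" "a \<in> F" "a \<subseteq> b" "b \<subseteq> pos_nats"
  shows "b \<in> F"
proof -
  have "infinite a"
    using assms by (auto simp: set_filter_def semifilter_def inf_sets_def)
  then have "b \<in> inf_sets"
    using assms(3,4) finite_subset by (auto simp: inf_sets_def)
  moreover have "almost_subset a b"
    unfolding almost_subset_def Diff_eq_empty_iff[THEN iffD2, OF assms(3)] by simp
  ultimately show ?thesis
    using assms(1,2) unfolding set_filter_def semifilter_def by blast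
qed

lemma set_filter_Int: "set_filter F \<Longrightarrow> a \<in> F \<Longrightarrow> b \<in> F \<Longrightarrow> a \<inter> b \<in> F"
  by (auto simp: set_filter_def)

lemma set_filter_infinite: "set_filter F \<Longrightarrow> a \<in> F \<Longrightarrow> infinite a"
  by (auto simp: set_filter_def semifilter_def inf_sets_def)

lemma set_filter_subset_pos: "set_filter F \<Longrightarrow> a \<in> F \<Longrightarrow> a \<subseteq> pos_nats"
  by (auto simp: set_filter_def semifilter_def inf_sets_def)

lemma set_filter_cofinite:
  assumes "set_filter F" "finite A"
  shows "pos_nats - A \<in> F"
proof -
  obtain a where a: "a \<in> F"
    using assms by (auto simp: set_filter_def semifilter_def)
  have "almost_subset a (pos_nats - A)"
    using assms set_filter_subset_pos[OF _ a]
    by (auto simp: almost_subset_def intro: finite_subset[of _ A])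
  moreover have "pos_nats - A \<in> inf_sets"
    using assms by (auto simp: inf_sets_def infinite_Ici)
  ultimately show ?thesis
    using assms a by (auto simp: set_filter_def semifilter_def)
qed

lemma set_filter_subset_dual_plus:
  assumes "set_filter F"
  shows "F \<subseteq> dual_plus F"
proof
  fix a assume a: "a \<in> F"
  have "pos_nats - a \<notin> F"
    using set_filter_Int[OF assms a, of "pos_nats - a"] set_filter_infinite[OF assms, of "{}"]
    by auto
  then show "a \<in> dual_plus F"
    using set_filter_infinite[OF assms a] set_filter_subset_pos[OF assms a]
    by (auto simp: dual_plus_def inf_sets_def)
qed

text \<open>Every filter lies inside its dual; the reverse inclusion comes from the ultrafilter
  dichotomy. This reduces the second claim of the theorem to the first.\<close>

lemma set_ultrafilter_dual_plus:
  assumes "set_ultrafilter F"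
  shows "dual_plus F = F"
  using assms set_filter_subset_dual_plus[of F]
  by (auto simp: set_ultrafilter_def dual_plus_def inf_sets_def)

lemma dual_plus_superset:
  assumes "set_filter F" "a \<in> dual_plus F" "a \<subseteq> b" "b \<subseteq> pos_nats"
  shows "b \<in> dual_plus F"
proof -
  have "pos_nats - b \<notin> F"
  proof
    assume "pos_nats - b \<in> F"
    then have "pos_nats - a \<in> F"
      by (rule set_filter_superset[OF assms(1)]) (use assms(3) in auto)
    with assms(2) show False by (simp add: dual_plus_def)
  qed
  moreover have "infinite b"
    using assms(2,3) infinite_super[of a b] by (simp add: dual_plus_def inf_sets_def)
  ultimately show ?thesis
    using assms(4) by (simp add: dual_plus_def inf_sets_def)
qed

text \<open>If the complement of \<open>a \<inter> b\<close> were in \<open>F\<close>, meeting it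
  with \<open>b\<close> would leave a set disjoint from \<open>a\<close>, and the complement of
  \<open>a\<close> would be in \<open>F\<close>. The intersection is infinite because
  \<open>F\<close> contains all cofinite sets.\<close>

lemma dual_plus_Int:
  assumes F: "set_filter F" and a: "a \<in> dual_plus F" and b: "b \<in> F"
  shows "a \<inter> b \<in> dual_plus F"
proof -
  have *: "pos_nats - (a \<inter> b) \<notin> F"
  proof
    assume "pos_nats - (a \<inter> b) \<in> F"
    then have "(pos_nats - (a \<inter> b)) \<inter> b \<in> F"
      using b by (rule set_filter_Int[OF F])
    then have "pos_nats - a \<in> F"
      by (rule set_filter_superset[OF F]) auto
    with a show False by (simp add: dual_plus_def)
  qed
  moreover have "infinite (a \<inter> b)"
    using * set_filter_cofinite[OF F] by blast
  ultimately show ?thesis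
    using a by (auto simp: dual_plus_def inf_sets_def)
qed

section \<open>Enumerations, domination and the bounding number\<close>

text \<open>Only the first \<open>n - 1\<close> elements of \<open>x\<close> can lie below
  \<open>k\<close>. This turns the order relations supplied by a scale into the cardinality
  condition of \<open>few_elements_nbhd\<close>.\<close>

lemma card_below_less:
  assumes "infinite x" "1 \<le> n" "k \<le> nth_elem x n"
  shows "card (x \<inter> {..<k}) < n"
proof -
  have "x \<inter> {..<k} \<subseteq> enumerate x ` {..<n - 1}"
  proof
    fix y assume y: "y \<in> x \<inter> {..<k}"
    then obtain i where i: "enumerate x i = y"
      using enumerate_Ex[OF assms(1)] by blast
    have "y < k" using y by simp
    also have "k \<le> enumerate x (n - 1)"
      using assms(3) by (simp only: nth_elem_def)
    finally have "enumerate x i < enumerate x (n - 1)"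
      by (simp only: i)
    then have "i < n - 1"
      using assms(1) by simp
    with i show "y \<in> enumerate x ` {..<n - 1}" by blast
  qed
  then have "card (x \<inter> {..<k}) \<le> card {..<n - 1}"
    by (meson card_image_le card_mono finite_imageI finite_lessThan le_trans)
  with assms show ?thesis by simp
qed

lemma ex_inf_sets_dominating:
  fixes f :: "nat \<Rightarrow> nat"
  shows "\<exists>a\<in>inf_sets. \<forall>n\<in>pos_nats. f n \<le> nth_elem a n"
proof -
  \<comment> \<open>The summands \<open>Suc (f i)\<close> make \<open>h\<close> strictly increasing
    and positive. Summing up to \<open>Suc n\<close> absorbs the index shift:
    \<open>nth_elem\<close> at \<open>Suc m\<close> is \<open>enumerate\<close> at \<open>m\<close>,
    and \<open>h m\<close> already exceeds \<open>f (Suc m)\<close>.\<close>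
  define h where "h n = (\<Sum>i\<le>Suc n. Suc (f i))" for n
  have h: "strict_mono h"
    by (auto simp: strict_mono_Suc_iff h_def)
  have inf: "infinite (range h)"
    using h strict_mono_imp_inj_on range_inj_infinite by blast
  have le: "h n \<le> enumerate (range h) n" for n
  proof (induction n)
    case 0
    have "enumerate (range h) 0 \<in> range h"
      using inf by (rule enumerate_in_set)
    with h show ?case
      by (auto simp: strict_mono_less_eq)
  next
    case (Suc n)
    have "enumerate (range h) (Suc n) \<in> range h"
      using inf by (rule enumerate_in_set)
    then obtain j where j: "enumerate (range h) (Suc n) = h j" by blast
    have "h n < h j"
      using Suc enumerate_step[OF inf, of n] j by simp
    with h j show ?case
      by (simp add: strict_mono_less strict_mono_less_eq)
  qed
  show ?thesis
  proof (intro bexI ballI)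
    show "range h \<in> inf_sets"
      using inf by (auto simp: inf_sets_def h_def)
    fix n :: nat assume "n \<in> pos_nats"
    then obtain m where m: "n = Suc m" by (cases n) auto
    have "f n \<le> h m"
      by (simp add: h_def m)
    with le[of m] show "f n \<le> nth_elem (range h) n"
      by (simp add: nth_elem_def m)
  qed
qed

text \<open>Transfers the meaning of \<open>bounding_number\<close> from infinite sets to arbitrary
  functions: each \<open>f i\<close> is dominated by the enumeration of a set \<open>a i\<close>,
  and these sets are too few to be unbounded.\<close>

lemma card_less_bounding_number_bounded:
  fixes f :: "'c \<Rightarrow> nat \<Rightarrow> nat"
  assumes F: "set_filter F" and I: "|I| <o bounding_number F"
  obtains g where "\<And>i. i \<in> I \<Longrightarrow> {n \<in> pos_nats. f i n \<le> g n} \<in> F"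
proof -
  have "\<exists>a. a \<in> inf_sets \<and> (\<forall>n\<in>pos_nats. f i n \<le> nth_elem a n)" for i
    using ex_inf_sets_dominating[of "f i"] by blast
  then obtain a where a: "\<And>i. a i \<in> inf_sets"
      "\<And>i n. n \<in> pos_nats \<Longrightarrow> f i n \<le> nth_elem (a i) n"
    by metis
  have "\<not> bounding_number F \<le>o |a ` I|"
    using I card_of_image[of a I] ordLeq_transitive not_ordLess_ordLeq by blast
  then have "\<not> unbounded_on F (a ` I)"
    using F bounding_number_minimal(2) by (auto simp: set_filter_def)
  then obtain d where d: "\<And>i. i \<in> I \<Longrightarrow> le_set (a i) d \<in> F"
    using a(1) unfolding unbounded_on_def le_on_def by blast
  show ?thesis
  proof
    fix i assume "i \<in> I"
    then have "le_set (a i) d \<in> F" by (rule d)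
    moreover have "le_set (a i) d \<subseteq> {n \<in> pos_nats. f i n \<le> nth_elem d n}"
      unfolding le_set_def using a(2)[of _ i] order_trans by blast
    ultimately show "{n \<in> pos_nats. f i n \<le> nth_elem d n} \<in> F"
      by (rule set_filter_superset[OF F]) auto
  qed
qed

section \<open>Cylinder neighbourhoods and countable subfamilies\<close>

text \<open>A basic open set of the Cantor space restricts finitely many coordinates;
  \<open>m\<close> is a bound above all of them.\<close>

lemma openin_prod_cantor_nbhd:
  assumes U: "openin (prod_topology (subtopology cantor_topology Z) Y) U" and xy: "(x, y) \<in> U"
  obtains m V where "openin Y V" "y \<in> V"
    "\<And>x' y'. x' \<in> Z \<inter> Pow pos_nats \<Longrightarrow> x' \<inter> {..<m} = x \<inter> {..<m} \<Longrightarrow> y' \<in> V \<Longrightarrow> (x', y') \<in> U"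
proof -
  define r :: "nat set \<Rightarrow> nat \<Rightarrow> bool" where "r a = restrict (\<lambda>n. n \<in> a) pos_nats" for a
  obtain A V where A: "openin (subtopology cantor_topology Z) A" and V: "openin Y V"
      and "x \<in> A" "y \<in> V" and AV: "A \<times> V \<subseteq> U"
    using U xy unfolding openin_prod_topology_alt by meson
  obtain A' where A': "openin cantor_topology A'" "A = A' \<inter> Z"
    using A by (auto simp: openin_subtopology)
  obtain W where W: "openin (product_topology (\<lambda>_. discrete_topology (UNIV :: bool set)) pos_nats) W"
      "A' = r -` W \<inter> Pow pos_nats"
    using A'(1) unfolding cantor_topology_def openin_pullback_topology r_def by blast
  have "r x \<in> W" using \<open>x \<in> A\<close> A' W by auto
  then obtain B where B: "finite {i \<in> pos_nats. B i \<noteq> (UNIV :: bool set)}"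
      "r x \<in> PiE pos_nats B" "PiE pos_nats B \<subseteq> W"
    using W(1) unfolding openin_product_topology_alt by fastforce
  obtain m where m: "\<And>i. i \<in> pos_nats \<Longrightarrow> B i \<noteq> UNIV \<Longrightarrow> i < m"
    using finite_nat_set_iff_bounded[THEN iffD1, OF B(1)] by blast
  show ?thesis
  proof
    fix x' y' assume x': "x' \<in> Z \<inter> Pow pos_nats" "x' \<inter> {..<m} = x \<inter> {..<m}" and "y' \<in> V"
    have "r x' i \<in> B i" if i: "i \<in> pos_nats" for i
    proof (cases "B i = UNIV")
      case False
      then have "i \<in> x' \<longleftrightarrow> i \<in> x"
        using m[OF i] x'(2) by blast
      then show ?thesis
        using B(2) i by (auto simp: r_def PiE_def Pi_def)
    qed simp
    then have "r x' \<in> PiE pos_nats B"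
      by (auto simp: r_def PiE_def)
    then have "x' \<in> A" using B(3) W(2) A'(2) x' by blast
    with \<open>y' \<in> V\<close> AV show "(x', y') \<in> U" by blast
  qed (use V \<open>y \<in> V\<close> in auto)
qed

lemma hereditarily_Lindelof_countable_subfamily:
  assumes Y: "hereditarily_Lindelof Y" and \<V>: "\<And>V. V \<in> \<V> \<Longrightarrow> openin Y V"
  obtains \<D> where "countable \<D>" "\<D> \<subseteq> \<V>" "\<Union>\<D> = \<Union>\<V>"
proof -
  have sub: "\<Union>\<V> \<subseteq> topspace Y"
    using \<V> openin_subset by blast
  then have "Lindelof_space (subtopology Y (\<Union>\<V>))"
    using Y by (simp add: hereditarily_Lindelof_def)
  then obtain \<D> where "countable \<D>" "\<D> \<subseteq> \<V>" "\<Union>\<V> \<subseteq> \<Union>\<D>"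
    unfolding Lindelof_space_subtopology_subset[OF sub] using \<V> by (meson order_refl)
  then show ?thesis by (intro that[of \<D>] equalityI) auto
qed

text \<open>There are only countably many cylinders, and the hereditary Lindelof property of
  \<open>Y\<close> can be applied to each of them separately.\<close>

lemma prod_cantor_countable_subfamily:
  assumes Y: "hereditarily_Lindelof Y"
    and \<U>: "\<And>U. U \<in> \<U> \<Longrightarrow> openin (prod_topology (subtopology cantor_topology Z) Y) U"
    and Z: "Z \<subseteq> Pow pos_nats"
  obtains \<C> where "countable \<C>" "\<C> \<subseteq> \<U>" "\<Union>\<C> = \<Union>\<U>"
proof -
  \<comment> \<open>The pair \<open>(s, m)\<close> codes the cylinder of all \<open>x\<close> with
    trace \<open>s\<close> below \<open>m\<close>; \<open>\<V> (s, m)\<close> collects the open sets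
    whose product with this cylinder fits into a single member of \<open>\<U>\<close>.\<close>
  define \<V> where "\<V> = (\<lambda>(s, m). {V. openin Y V \<and>
      (\<exists>U\<in>\<U>. \<forall>x\<in>Z. \<forall>y\<in>V. x \<inter> {..<m} = s \<longrightarrow> (x, y) \<in> U)})"
  have "\<exists>\<D>. countable \<D> \<and> \<D> \<subseteq> \<V> p \<and> \<Union>\<D> = \<Union>(\<V> p)" for p
    using hereditarily_Lindelof_countable_subfamily[OF Y, of "\<V> p"] unfolding \<V>_def
    by (smt (verit, best) case_prod_beta mem_Collect_eq)
  then obtain \<D> where \<D>: "\<And>p. countable (\<D> p)" "\<And>p. \<D> p \<subseteq> \<V> p" "\<And>p. \<Union>(\<D> p) = \<Union>(\<V> p)"
    by metis
  have "\<forall>s m. \<forall>V \<in> \<V> (s, m). \<exists>U. U \<in> \<U> \<and> (\<forall>x\<in>Z. \<forall>y\<in>V. x \<inter> {..<m} = s \<longrightarrow> (x, y) \<in> U)"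
    by (auto simp: \<V>_def)
  then obtain u where u: "\<And>s m V. V \<in> \<V> (s, m) \<Longrightarrow> u s m V \<in> \<U>"
      "\<And>s m V x y. V \<in> \<V> (s, m) \<Longrightarrow> x \<in> Z \<Longrightarrow> y \<in> V \<Longrightarrow> x \<inter> {..<m} = s \<Longrightarrow> (x, y) \<in> u s m V"
    by metis
  define I where "I = {s :: nat set. finite s} \<times> (UNIV :: nat set)"
  have "countable I"
    by (auto simp: I_def countable_Collect_finite)
  define \<C> where "\<C> = (\<Union>(s, m)\<in>I. u s m ` \<D> (s, m))"
  show ?thesis
  proof
    show "countable \<C>"
      unfolding \<C>_def using \<open>countable I\<close> \<D>(1) by (auto intro!: countable_UN)
    show "\<C> \<subseteq> \<U>"
      unfolding \<C>_def using u(1) \<D>(2) by blast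
    have "\<Union>\<U> \<subseteq> \<Union>\<C>"
    proof clarify
      fix x y U assume U: "U \<in> \<U>" "(x, y) \<in> U"
      then have x: "x \<in> Z"
        using openin_subset[OF \<U>[OF U(1)]] by auto
      obtain m V where mV: "openin Y V" "y \<in> V"
          "\<And>x' y'. x' \<in> Z \<inter> Pow pos_nats \<Longrightarrow> x' \<inter> {..<m} = x \<inter> {..<m} \<Longrightarrow> y' \<in> V \<Longrightarrow> (x', y') \<in> U"
        using openin_prod_cantor_nbhd[OF \<U>[OF U(1)] U(2)] by metis
      let ?s = "x \<inter> {..<m}"
      have "V \<in> \<V> (?s, m)"
        unfolding \<V>_def using mV(1,3) U(1) Z by blast
      then obtain V' where V': "V' \<in> \<D> (?s, m)" "y \<in> V'"
        using \<D>(3)[of "(?s, m)"] mV(2) by blast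
      have "(x, y) \<in> u ?s m V'"
        using u(2) V' \<D>(2) x by blast
      moreover have "(?s, m) \<in> I"
        by (simp add: I_def)
      ultimately show "(x, y) \<in> \<Union>\<C>"
        unfolding \<C>_def using V'(1) by blast
    qed
    with \<open>\<C> \<subseteq> \<U>\<close> show "\<Union>\<C> = \<Union>\<U>" by blast
  qed
qed

section \<open>Increasing covers and the Menger property\<close>

lemma countable_finite_exhaustion:
  assumes "countable \<C>"
  obtains G :: "nat \<Rightarrow> 'a set" where "\<And>k. finite (G k)" "mono G" "(\<Union>k. G k) = \<C>"
proof
  let ?G = "\<lambda>k. {U \<in> \<C>. to_nat_on \<C> U < k}"
  show "finite (?G k)" for k
  proof (rule inj_on_finite[where f = "to_nat_on \<C>" and B = "{..<k}"])
    show "inj_on (to_nat_on \<C>) (?G k)"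
      using inj_on_to_nat_on[OF assms] by (rule inj_on_subset) auto
  qed auto
  show "mono ?G" by (auto simp: mono_def)
  show "(\<Union>k. ?G k) = \<C>" by auto
qed

text \<open>A finite subfamily of an increasing sequence is contained in one of its terms, so a
  Menger selection amounts to a function.\<close>

lemma Menger_space_increasing_open:
  assumes F: "set_filter F" and Y: "Menger_space F Y"
    and op: "\<And>n k. n \<in> pos_nats \<Longrightarrow> openin Y (V n k)"
    and mono: "\<And>n. mono (V n)"
    and cover: "\<And>n. n \<in> pos_nats \<Longrightarrow> topspace Y \<subseteq> (\<Union>k::nat. V n k)"
  shows "\<exists>f. \<forall>y\<in>topspace Y. {n \<in> pos_nats. y \<in> V n (f n)} \<in> F"
proof -
  have "\<forall>n\<in>pos_nats. open_cover Y (range (V n))"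
    unfolding open_cover_def using op cover openin_subset by blast
  from Y[unfolded Menger_space_def, THEN spec, THEN mp, OF this]
  obtain \<F> where \<F>: "\<forall>n\<in>pos_nats. finite (\<F> n) \<and> \<F> n \<subseteq> range (V n)"
      "\<forall>y\<in>topspace Y. {n \<in> pos_nats. y \<in> \<Union>(\<F> n)} \<in> F"
    by (elim exE conjE)
  have "\<exists>k. \<Union>(\<F> n) \<subseteq> V n k" if n: "n \<in> pos_nats" for n
  proof -
    obtain K where K: "finite K" "\<F> n = V n ` K"
      using bspec[OF \<F>(1) n] by (meson finite_subset_image)
    \<comment> \<open>For empty \<open>K\<close> the value \<open>Max K\<close> is unspecified, but
      then the union on the left is empty.\<close>
    have "\<Union>(\<F> n) \<subseteq> V n (Max K)"
      using K monoD[OF mono Max_ge[OF K(1)]] by blast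
    then show ?thesis ..
  qed
  then obtain f where f: "\<And>n. n \<in> pos_nats \<Longrightarrow> \<Union>(\<F> n) \<subseteq> V n (f n)"
    by metis
  show ?thesis
  proof (intro exI ballI)
    fix y assume "y \<in> topspace Y"
    then have "{n \<in> pos_nats. y \<in> \<Union>(\<F> n)} \<in> F"
      using \<F>(2) by blast
    then show "{n \<in> pos_nats. y \<in> V n (f n)} \<in> F"
      by (rule set_filter_superset[OF F]) (use f in blast)+
  qed
qed

section \<open>Neighbourhoods that handle all sets with few elements\<close>

lemma Int_lessThan_eq_mono:
  fixes l m :: nat
  assumes "x \<inter> {..<m} = s \<inter> {..<m}" "l \<le> m"
  shows "x \<inter> {..<l} = s \<inter> {..<l}"
proof -
  have *: "t \<inter> {..<l} = (t \<inter> {..<m}) \<inter> {..<l}" for t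
    using assms(2) by auto
  have "x \<inter> {..<l} = (x \<inter> {..<m}) \<inter> {..<l}" by (rule *)
  also have "\<dots> = (s \<inter> {..<m}) \<inter> {..<l}" by (simp only: assms(1))
  also have "\<dots> = s \<inter> {..<l}" by (rule *[symmetric])
  finally show ?thesis .
qed

text \<open>Pigeonhole: with \<open>0 = m\<^sub>0 \<le> m\<^sub>1 \<le> \<dots> \<le> m\<^sub>n\<close> chosen so that finite subsets of \<open>{..<m\<^sub>i}\<close>
  are treated by cylinders of length \<open>m\<^sub>i\<^sub>+\<^sub>1\<close>, a set with fewer than \<open>n\<close> elements below \<open>m\<^sub>n\<close>
  misses one of the intervals \<open>{m\<^sub>i..<m\<^sub>i\<^sub>+\<^sub>1}\<close>.\<close>

lemma few_elements_nbhd: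
  assumes op: "\<And>k. openin (prod_topology (subtopology cantor_topology Z) Y) (W k)"
    and mono: "mono W"
    and cover: "fin_sets \<times> topspace Y \<subseteq> (\<Union>k::nat. W k)"
    and Z: "Z \<subseteq> Pow pos_nats" and y: "y \<in> topspace Y"
  shows "\<exists>k V. openin Y V \<and> y \<in> V \<and>
     (\<forall>x\<in>Z. \<forall>y'\<in>V. card (x \<inter> {..<k}) < n \<longrightarrow> (x, y') \<in> W k)"
proof (induction n)
  case 0
  show ?case using y by auto
next
  case (Suc n)
  then obtain m V where V: "openin Y V" "y \<in> V"
      "\<And>x y'. x \<in> Z \<Longrightarrow> y' \<in> V \<Longrightarrow> card (x \<inter> {..<m}) < n \<Longrightarrow> (x, y') \<in> W m"
    by blast
  \<comment> \<open>The finitely many possible traces below \<open>m\<close> of members of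
    \<open>Z\<close>.\<close>
  define P where "P = {s. s \<subseteq> {1..<m}}"
  have "\<exists>k B. openin Y B \<and> y \<in> B \<and>
      (\<forall>x\<in>Z. \<forall>y'\<in>B. x \<inter> {..<k} = s \<inter> {..<k} \<longrightarrow> (x, y') \<in> W k)" if "s \<in> P" for s
  proof -
    have "s \<in> fin_sets"
      using that finite_subset[OF _ finite_atLeastLessThan, of s 1 m]
      by (auto simp: P_def fin_sets_def)
    then obtain j where j: "(s, y) \<in> W j" using cover y by blast
    obtain l B where B: "openin Y B" "y \<in> B"
      "\<And>x y'. x \<in> Z \<inter> Pow pos_nats \<Longrightarrow> x \<inter> {..<l} = s \<inter> {..<l} \<Longrightarrow> y' \<in> B \<Longrightarrow> (x, y') \<in> W j"
      by (rule openin_prod_cantor_nbhd[OF op j]) blast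
    \<comment> \<open>Taking the maximum lets one number serve both as cylinder length and as index
      of \<open>W\<close>: agreement further up is a stronger condition, and \<open>W\<close>
      increases.\<close>
    have "(x, y') \<in> W (max j l)"
      if "x \<in> Z" "y' \<in> B" "x \<inter> {..<max j l} = s \<inter> {..<max j l}" for x y'
    proof -
      have "x \<inter> {..<l} = s \<inter> {..<l}"
        by (rule Int_lessThan_eq_mono[OF that(3)]) simp
      moreover have "x \<in> Z \<inter> Pow pos_nats"
        using that(1) Z by blast
      ultimately have "(x, y') \<in> W j"
        using B(3) that(2) by blast
      then show ?thesis
        using monoD[OF mono, of j "max j l"] by auto
    qed
    with B(1,2) show ?thesis
      by (intro exI[of _ "max j l"] exI[of _ B] conjI ballI impI)
  qed
  then obtain k B where kB: "\<And>s. s \<in> P \<Longrightarrow> openin Y (B s) \<and> y \<in> B s"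
      "\<And>s x y'. s \<in> P \<Longrightarrow> x \<in> Z \<Longrightarrow> y' \<in> B s \<Longrightarrow> x \<inter> {..<k s} = s \<inter> {..<k s} \<Longrightarrow> (x, y') \<in> W (k s)"
    by metis
  \<comment> \<open>The member \<open>{}\<close> keeps the finite intersection over \<open>P\<close>
    nonempty-indexed, hence open.\<close>
  have P: "finite P" "{} \<in> P" by (auto simp: P_def)
  define K where "K = Max (insert m (k ` P))"
  have K: "m \<le> K" "\<And>s. s \<in> P \<Longrightarrow> k s \<le> K"
    using P by (auto simp: K_def)
  define V' where "V' = V \<inter> \<Inter>(B ` P)"
  have "openin Y (\<Inter>(B ` P))"
    using P kB(1) by (intro openin_INT2) auto
  then have V': "openin Y V'" "y \<in> V'"
    using V kB(1) by (auto simp: V'_def)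
  have "(x, y') \<in> W K" if x: "x \<in> Z" "y' \<in> V'" "card (x \<inter> {..<K}) < Suc n" for x y'
  proof (cases "card (x \<inter> {..<m}) < n")
    case True
    then show ?thesis
      using V(3) x monoD[OF mono K(1)] by (auto simp: V'_def)
  next
    case False
    \<comment> \<open>At least \<open>n\<close> elements lie below \<open>m\<close> and at most
      \<open>n\<close> below \<open>K\<close>, so \<open>x\<close> has none in between and agrees up
      to \<open>K\<close> with the finite set \<open>s\<close>.\<close>
    have "x \<inter> {..<m} = x \<inter> {..<K}"
      using K(1) False x(3) by (intro card_seteq) auto
    define s where "s = x \<inter> {..<m}"
    have s: "s \<in> P" using x(1) Z by (fastforce simp: s_def P_def)
    have "x \<inter> {..<K} = s \<inter> {..<K}"
      unfolding s_def \<open>x \<inter> {..<m} = x \<inter> {..<K}\<close> by blast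
    then have "x \<inter> {..<k s} = s \<inter> {..<k s}"
      using K(2)[OF s] by (rule Int_lessThan_eq_mono)
    then have "(x, y') \<in> W (k s)"
      using kB(2)[OF s x(1)] x(2) s by (auto simp: V'_def)
    with monoD[OF mono K(2)[OF s]] show ?thesis by blast
  qed
  with V' show ?case by blast
qed

section \<open>The product of a scale with a Menger space\<close>

lemma scale_prod_Menger:
  fixes Y :: "'b topology"
  assumes F: "set_filter F" and X: "is_scale F X"
    and HL: "hereditarily_Lindelof Y" and Y: "Menger_space F Y"
  shows "Menger_space (dual_plus F)
           (prod_topology (subtopology cantor_topology (X \<union> fin_sets)) Y)"
    (is "Menger_space _ ?T")
  unfolding Menger_space_def
proof (intro allI impI)
  fix \<U> :: "nat \<Rightarrow> (nat set \<times> 'b) set set"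
  assume \<U>: "\<forall>n\<in>pos_nats. open_cover ?T (\<U> n)"
  define Z where "Z = X \<union> fin_sets"
  have XI: "X \<subseteq> inf_sets" using X by (simp add: is_scale_def)
  then have Z: "Z \<subseteq> Pow pos_nats"
    by (auto simp: Z_def fin_sets_def inf_sets_def)
  have "topspace cantor_topology = Pow pos_nats"
    by (auto simp: cantor_topology_def topspace_pullback_topology PiE_def)
  then have top: "topspace ?T = Z \<times> topspace Y"
    using Z by (auto simp: Z_def)
  have "\<exists>G. (\<forall>k::nat. finite (G k) \<and> G k \<subseteq> \<U> n) \<and> mono G \<and> (\<Union>k. \<Union>(G k)) = Z \<times> topspace Y"
    if n: "n \<in> pos_nats" for n
  proof -
    have op: "\<And>U. U \<in> \<U> n \<Longrightarrow> openin ?T U" and un: "\<Union>(\<U> n) = Z \<times> topspace Y"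
      using \<U> n top by (auto simp: open_cover_def)
    obtain \<C> where \<C>: "countable \<C>" "\<C> \<subseteq> \<U> n" "\<Union>\<C> = \<Union>(\<U> n)"
      using prod_cantor_countable_subfamily[OF HL op] Z unfolding Z_def by metis
    obtain G :: "nat \<Rightarrow> _" where G: "\<And>k. finite (G k)" "mono G" "(\<Union>k. G k) = \<C>"
      using countable_finite_exhaustion[OF \<C>(1)] by metis
    have "(\<Union>k. \<Union>(G k)) = \<Union>(\<Union>k. G k)" by blast
    also have "\<dots> = Z \<times> topspace Y"
      by (simp only: G(3) \<C>(3) un)
    finally have "(\<Union>k. \<Union>(G k)) = Z \<times> topspace Y" .
    moreover have "G k \<subseteq> \<U> n" for k
      using G(3) \<C>(2) by blast
    ultimately show ?thesis
      using G(1,2) by (intro exI[of _ G] conjI allI)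
  qed
  then obtain G where G: "\<And>n k. n \<in> pos_nats \<Longrightarrow> finite (G n (k::nat)) \<and> G n k \<subseteq> \<U> n"
      "\<And>n. n \<in> pos_nats \<Longrightarrow> mono (G n)"
      "\<And>n. n \<in> pos_nats \<Longrightarrow> (\<Union>k. \<Union>(G n k)) = Z \<times> topspace Y"
    by metis
  \<comment> \<open>The empty value at \<open>n = 0\<close> makes openness and monotonicity hold for
    every \<open>n\<close>.\<close>
  define W where "W n k = (if n \<in> pos_nats then \<Union>(G n k) else {})" for n k
  have W_eq: "W n k = \<Union>(G n k)" if "n \<in> pos_nats" for n k
    using that by (simp add: W_def)
  have W_op: "openin (prod_topology (subtopology cantor_topology Z) Y) (W n k)" for n k
    using \<U> G(1)[of n k] unfolding W_def open_cover_def Z_def by (auto intro!: openin_Union)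
  have W_mono: "mono (W n)" for n
    using G(2)[of n] by (auto simp: W_def mono_def)
  have W_cover: "(\<Union>k. W n k) = Z \<times> topspace Y" if "n \<in> pos_nats" for n
    using G(3)[OF that] W_eq[OF that] by simp

  \<comment> \<open>The largest open set of points treated uniformly by stage \<open>k\<close>. It
    grows with \<open>k\<close>, since the cardinality condition gets harder to meet while
    \<open>W n k\<close> grows.\<close>
  define V where "V n k = \<Union>{B. openin Y B \<and>
      (\<forall>x\<in>Z. \<forall>y\<in>B. card (x \<inter> {..<k}) < n \<longrightarrow> (x, y) \<in> W n k)}" for n k
  have V_op: "openin Y (V n k)" for n k
    unfolding V_def by (rule openin_Union) auto
  have V_D: "(x, y) \<in> W n k" if "y \<in> V n k" "x \<in> Z" "card (x \<inter> {..<k}) < n" for x y n k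
    using that unfolding V_def by blast
  have V_mono: "mono (V n)" for n
  proof (rule monoI)
    fix k k' :: nat assume "k \<le> k'"
    have "card (x \<inter> {..<k}) \<le> card (x \<inter> {..<k'})" for x
      using \<open>k \<le> k'\<close> by (intro card_mono) auto
    then show "V n k \<subseteq> V n k'"
      unfolding V_def using monoD[OF W_mono \<open>k \<le> k'\<close>, of n]
      by (intro Union_mono) (fast intro: le_less_trans)
  qed
  have V_cover: "topspace Y \<subseteq> (\<Union>k. V n k)" if n: "n \<in> pos_nats" for n
  proof
    fix y assume "y \<in> topspace Y"
    have "fin_sets \<times> topspace Y \<subseteq> (\<Union>k. W n k)"
      unfolding W_cover[OF n] Z_def by blast
    from few_elements_nbhd[OF W_op W_mono this Z \<open>y \<in> topspace Y\<close>, of n]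
    obtain k B where "openin Y B" "y \<in> B"
        "\<forall>x\<in>Z. \<forall>y'\<in>B. card (x \<inter> {..<k}) < n \<longrightarrow> (x, y') \<in> W n k"
      by (elim exE conjE)
    then show "y \<in> (\<Union>k. V n k)"
      unfolding V_def by blast
  qed
  have "\<exists>k. \<forall>y\<in>topspace Y. {n \<in> pos_nats. y \<in> V n (k n)} \<in> F"
    by (rule Menger_space_increasing_open[OF F Y V_op V_mono V_cover])
  then obtain k where k: "\<And>y. y \<in> topspace Y \<Longrightarrow> {n \<in> pos_nats. y \<in> V n (k n)} \<in> F"
    by blast

  \<comment> \<open>The slices of \<open>W n k\<close> at a fixed \<open>x\<close> form increasing
    open covers of \<open>Y\<close>, so each \<open>x\<close> has its own selection; these are
    needed for the exceptional points of the scale.\<close>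
  have "\<exists>f. \<forall>y\<in>topspace Y. {n \<in> pos_nats. (x, y) \<in> W n (f n)} \<in> F" if x: "x \<in> Z" for x
  proof -
    define S where "S n k = {y \<in> topspace Y. (x, y) \<in> W n k}" for n k
    have "openin Y (S n k)" for n k
    proof (subst openin_subopen, intro ballI)
      fix y assume "y \<in> S n k"
      then have y: "(x, y) \<in> W n k" by (simp add: S_def)
      obtain m B where B: "openin Y B" "y \<in> B" "\<And>x' y'. x' \<in> Z \<inter> Pow pos_nats \<Longrightarrow>
          x' \<inter> {..<m} = x \<inter> {..<m} \<Longrightarrow> y' \<in> B \<Longrightarrow> (x', y') \<in> W n k"
        by (rule openin_prod_cantor_nbhd[OF W_op y]) blast
      then have "B \<subseteq> S n k"
        using x Z openin_subset[OF B(1)] by (auto simp: S_def)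
      with B show "\<exists>T. openin Y T \<and> y \<in> T \<and> T \<subseteq> S n k" by blast
    qed
    moreover have "mono (S n)" for n
      using W_mono[of n] by (auto simp: S_def mono_def)
    moreover have "topspace Y \<subseteq> (\<Union>k. S n k)" if "n \<in> pos_nats" for n
      using W_cover[OF that] x by (auto simp: S_def)
    ultimately have "\<exists>f. \<forall>y\<in>topspace Y. {n \<in> pos_nats. y \<in> S n (f n)} \<in> F"
      by (rule Menger_space_increasing_open[OF F Y])
    then show ?thesis by (simp add: S_def)
  qed
  then obtain f where f: "\<And>x y. x \<in> Z \<Longrightarrow> y \<in> topspace Y \<Longrightarrow> {n \<in> pos_nats. (x, y) \<in> W n (f x n)} \<in> F"
    by metis

  \<comment> \<open>The scale is applied to a set \<open>b\<close> dominating \<open>k\<close>; the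
    exceptional \<open>x\<close> are then few enough for their functions \<open>f x\<close> to have
    a common bound \<open>g\<close> modulo \<open>F\<close>.\<close>
  obtain b where b: "b \<in> inf_sets" "\<And>n. n \<in> pos_nats \<Longrightarrow> k n \<le> nth_elem b n"
    using ex_inf_sets_dominating[of k] by blast
  obtain c where c: "le_set b c \<in> dual_plus F"
      "|{x \<in> X. \<not> le_on F c x}| <o bounding_number F"
    using X b(1) unfolding is_scale_def le_on_def by blast
  obtain g where g: "\<And>x. x \<in> X \<Longrightarrow> \<not> le_on F c x \<Longrightarrow> {n \<in> pos_nats. f x n \<le> g n} \<in> F"
    by (rule card_less_bounding_number_bounded[OF F c(2), of f]) blast
  define h where "h n = max (k n) (g n)" for n

  have main: "{n \<in> pos_nats. (x, y) \<in> W n (h n)} \<in> dual_plus F"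
    if x: "x \<in> Z" and y: "y \<in> topspace Y" for x y
  proof -
    have Wh: "(x, y) \<in> W n (h n)" if "y \<in> V n (k n)" "card (x \<inter> {..<k n}) < n" for n
      using V_D[OF that(1) x that(2)] monoD[OF W_mono, of "k n" "h n" n] by (auto simp: h_def)
    consider "x \<in> fin_sets" | "x \<in> X" "le_on F c x" | "x \<in> X" "\<not> le_on F c x"
      using x by (auto simp: Z_def)
    then show ?thesis
    proof cases
      case 1
      then have "finite x" by (simp add: fin_sets_def)
      \<comment> \<open>For finite \<open>x\<close> the cardinality condition holds as soon as
        \<open>n\<close> exceeds \<open>card x\<close>, which excludes only finitely many
        \<open>n\<close>.\<close>
      have "{n \<in> pos_nats. y \<in> V n (k n)} \<inter> (pos_nats - {..card x}) \<in> F"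
        using k[OF y] set_filter_cofinite[OF F] by (intro set_filter_Int[OF F]) auto
      moreover have "card (x \<inter> {..<k n}) < n" if "\<not> n \<le> card x" for n
        using card_mono[OF \<open>finite x\<close>, of "x \<inter> {..<k n}"] that by simp
      ultimately have "{n \<in> pos_nats. (x, y) \<in> W n (h n)} \<in> F"
        using Wh by (elim set_filter_superset[OF F]) auto
      then show ?thesis using set_filter_subset_dual_plus[OF F] by blast
    next
      case 2
      then have "infinite x" using XI by (auto simp: inf_sets_def)
      \<comment> \<open>On this set \<open>k n \<le> b(n) \<le> c(n) \<le> x(n)\<close>. This is the
        only case giving a member of \<open>dual_plus F\<close> rather than of \<open>F\<close>,
        because \<open>b\<close> is below \<open>c\<close> only in that sense.\<close>
      have "le_set b c \<inter> (le_set c x \<inter> {n \<in> pos_nats. y \<in> V n (k n)}) \<in> dual_plus F"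
        using c(1) k[OF y] 2 unfolding le_on_def
        by (intro dual_plus_Int[OF F] set_filter_Int[OF F])
      moreover have "card (x \<inter> {..<k n}) < n" if "n \<in> le_set b c" "n \<in> le_set c x" for n
      proof (rule card_below_less[OF \<open>infinite x\<close>])
        show "1 \<le> n" using that by (auto simp: le_set_def)
        show "k n \<le> nth_elem x n"
          using b(2)[of n] that unfolding le_set_def by fastforce
      qed
      ultimately show ?thesis
        using Wh by (elim dual_plus_superset[OF F]) auto
    next
      case 3
      have "{n \<in> pos_nats. f x n \<le> g n} \<inter> {n \<in> pos_nats. (x, y) \<in> W n (f x n)} \<in> F"
        using g[OF 3] f[OF x y] by (rule set_filter_Int[OF F])
      moreover have "(x, y) \<in> W n (h n)" if "f x n \<le> g n" "(x, y) \<in> W n (f x n)" for n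
      proof -
        have "f x n \<le> h n" using that(1) by (simp add: h_def)
        then show ?thesis using monoD[OF W_mono] that(2) by blast
      qed
      ultimately have "{n \<in> pos_nats. (x, y) \<in> W n (h n)} \<in> F"
        by (elim set_filter_superset[OF F]) auto
      then show ?thesis using set_filter_subset_dual_plus[OF F] by blast
    qed
  qed
  have "{n \<in> pos_nats. p \<in> \<Union>(G n (h n))} \<in> dual_plus F" if p: "p \<in> topspace ?T" for p
  proof -
    obtain x y where xy: "p = (x, y)" "x \<in> Z" "y \<in> topspace Y"
      using p top by auto
    have "{n \<in> pos_nats. p \<in> \<Union>(G n (h n))} = {n \<in> pos_nats. (x, y) \<in> W n (h n)}"
      using W_eq xy(1) by blast
    with main[OF xy(2,3)] show ?thesis by simp
  qed
  then show "\<exists>\<F>. (\<forall>n\<in>pos_nats. finite (\<F> n) \<and> \<F> n \<subseteq> \<U> n) \<and>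
      (\<forall>p\<in>topspace ?T. {n \<in> pos_nats. p \<in> \<Union>(\<F> n)} \<in> dual_plus F)"
    using G(1) by (intro exI[of _ "\<lambda>n. G n (h n)"]) simp
qed

theorem theorem5p3:
  fixes F :: "nat set set" and X :: "nat set set"
  assumes "set_filter F" and "is_scale F X"
  shows "(\<forall>Y :: 'b topology. hereditarily_Lindelof Y \<and> Menger_space F Y \<longrightarrow>
            Menger_space (dual_plus F)
              (prod_topology (subtopology cantor_topology (X \<union> fin_sets)) Y)) \<and>
         (set_ultrafilter F \<longrightarrow>
            (\<forall>Y :: 'b topology. hereditarily_Lindelof Y \<and> Menger_space F Y \<longrightarrow>
               Menger_space F
                 (prod_topology (subtopology cantor_topology (X \<union> fin_sets)) Y)))"
proof (intro conjI allI impI)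
  fix Y :: "'b topology"
  assume Y: "hereditarily_Lindelof Y \<and> Menger_space F Y"
  then show *: "Menger_space (dual_plus F)
      (prod_topology (subtopology cantor_topology (X \<union> fin_sets)) Y)"
    using scale_prod_Menger[OF assms] by blast
  assume "set_ultrafilter F"
  then show "Menger_space F (prod_topology (subtopology cantor_topology (X \<union> fin_sets)) Y)"
    using * by (simp add: set_ultrafilter_dual_plus)
qed

end
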